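(* Let $M$ be an arbitrary left $\mathbb{O}$-module and let $m\in M$ be an element of length $(n,k)$. Then the submodule $\langle m\rangle_{\mathbb{O}}$ of $M$ generated by $m$ is of type $(n,k)$.
   Context: $\mathbb{O}$ denotes the real $8$-dimensional division algebra of octonions, with conjugation $p\mapsto\overline{p}$. A left $\mathbb{O}$-module is a real vector space $M$ with an $\mathbb{R}$-bilinear map $\mathbb{O}\times M\to M$, $(q,m)\mapsto qm$, such that $1m=m$ and $[p,q,m]=-[q,p,m]$ for all $p,q\in\mathbb{O}$, $m\in M$, where $[p,q,m]:=(pq)m-p(qm)$. Submodules are real subspaces closed under the action of $\mathbb{O}$, and $\langle m\rangle_{\mathbb{O}}$ is the smallest submodule containing $m$. $\mathbb{O}$ is a left module over itself via multiplication, and $\overline{\mathbb{O}}$ denotes the left $\mathbb{O}$-module with underlying real space $\mathbb{O}$ and action $p\star x:=\overline{p}x$. Associative elements: $\mathcal{A}(M):=\{m\in M\mid (pq)m-p(qm)=0\ \forall p,q\in\mathbb{O}\}$. Conjugate associative elements: $\mathcal{A}^{-}(M):=\{m\in M\mid (pq)m-q(pm)=0\ \forall p,q\in\mathbb{O}\}$. For a real subspace $U$ of $M$, $\mathbb{O}U$ is the real span of all $pu$, $p\in\mathbb{O}$, $u\in U$. It is known that $M=M^{+}\oplus M^{-}$, where $M^{+}=\mathbb{O}\mathcal{A}(M)$ and $M^{-}=\mathbb{O}\mathcal{A}^{-}(M)$ are submodules. The type of $M$ is the pair $(\dim_{\mathbb{R}}\mathcal{A}(M),\dim_{\mathbb{R}}\mathcal{A}^{-}(M))$;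 it determines $M$ up to isomorphism. Let $\mathcal{C}^{+}(M)$ be the set consisting of $0$ and all $m\in M$ with $\langle m\rangle_{\mathbb{O}}=\mathbb{O}m\cong\mathbb{O}$, and $\mathcal{C}^{-}(M)$ the set consisting of $0$ and all $m\in M$ with $\langle m\rangle_{\mathbb{O}}=\mathbb{O}m\cong\overline{\mathbb{O}}$ (isomorphisms of left $\mathbb{O}$-modules). Length: write $m=m^{+}+m^{-}$ with $m^{\pm}\in M^{\pm}$. The length of $m$ is the pair $(\ell_m^{+},\ell_m^{-})$, where $\ell_m^{+}$ (resp. $\ell_m^{-}$) is the smallest integer $r\ge 0$ such that $m^{+}$ (resp. $m^{-}$) is a sum of $r$ elements of $\mathcal{C}^{+}(M)$ (resp. $\mathcal{C}^{-}(M)$). *)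

theory Defs
  imports "HOL-Analysis.Analysis"
begin

section \<open>The octonions, by iterated Cayley--Dickson doubling of the complex numbers\<close>

text \<open>
  The product types carry the componentwise real vector space structure and the Euclidean norm.
  The doubling formula is
  \<open>(a, b) (c, d) = (a c - d\<^sup>* b, d a + b c\<^sup>*)\<close>, \<open>(a, b)\<^sup>* = (a\<^sup>*, - b)\<close>.
\<close>

type_synonym quaternion = "complex \<times> complex"
type_synonym octonion = "quaternion \<times> quaternion"

fun qmul :: "quaternion \<Rightarrow> quaternion \<Rightarrow> quaternion" where
  "qmul (a, b) (c, d) = (a * c - cnj d * b, d * a + b * cnj c)"

fun qcnj :: "quaternion \<Rightarrow> quaternion" where
  "qcnj (a, b) = (cnj a, - b)"

fun omul :: "octonion \<Rightarrow> octonion \<Rightarrow> octonion" where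
  "omul (a, b) (c, d) = (qmul a c - qmul (qcnj d) b, qmul d a + qmul b (qcnj c))"

fun ocnj :: "octonion \<Rightarrow> octonion" where
  "ocnj (a, b) = (qcnj a, - b)"

definition oone :: octonion where
  "oone = ((1, 0), (0, 0))"


section \<open>Left octonion modules\<close>

text \<open>
  A module structure on the real vector space given by the type \<open>'m\<close> is its action
  \<open>act :: octonion \<Rightarrow> 'm \<Rightarrow> 'm\<close>.
\<close>

definition assoc3 :: "(octonion \<Rightarrow> 'm \<Rightarrow> 'm) \<Rightarrow> octonion \<Rightarrow> octonion \<Rightarrow> 'm::real_vector \<Rightarrow> 'm" where
  "assoc3 act p q x = act (omul p q) x - act p (act q x)"

definition oct_module :: "(octonion \<Rightarrow> 'm \<Rightarrow> 'm::real_vector) \<Rightarrow> bool" where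
  "oct_module act \<longleftrightarrow>
     bilinear act \<and>
     (\<forall>x. act oone x = x) \<and>
     (\<forall>p q x. assoc3 act p q x = - assoc3 act q p x)"

definition oct_submodule :: "(octonion \<Rightarrow> 'm \<Rightarrow> 'm::real_vector) \<Rightarrow> 'm set \<Rightarrow> bool" where
  "oct_submodule act N \<longleftrightarrow> subspace N \<and> (\<forall>p. \<forall>x\<in>N. act p x \<in> N)"

definition oct_gen :: "(octonion \<Rightarrow> 'm \<Rightarrow> 'm::real_vector) \<Rightarrow> 'm \<Rightarrow> 'm set" where
  "oct_gen act x = oct_submodule act hull {x}"

lemma oct_submodule_oct_gen: "oct_submodule act (oct_gen act x)"
proof -
  have "oct_submodule act (\<Inter> T)" if "\<forall>N\<in>T. oct_submodule act N" for T
    using that by (auto simp: oct_submodule_def intro!: subspace_Inter)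
  then show ?thesis
    unfolding oct_gen_def by (metis hull_in)
qed

text \<open>Isomorphism of the submodules \<open>V\<close> and \<open>W\<close> of two (possibly different) octonion modules.\<close>

definition oct_iso ::
  "(octonion \<Rightarrow> 'm \<Rightarrow> 'm::real_vector) \<Rightarrow> 'm set \<Rightarrow>
   (octonion \<Rightarrow> 'n \<Rightarrow> 'n::real_vector) \<Rightarrow> 'n set \<Rightarrow> bool" where
  "oct_iso act V act' W \<longleftrightarrow>
     (\<exists>f. bij_betw f V W \<and>
          (\<forall>x\<in>V. \<forall>y\<in>V. f (x + y) = f x + f y) \<and>
          (\<forall>r. \<forall>x\<in>V. f (r *\<^sub>R x) = r *\<^sub>R f x) \<and>
          (\<forall>p. \<forall>x\<in>V. f (act p x) = act' p (f x)))"

text \<open>The conjugate regular module; the regular module has action \<^const>\<open>omul\<close>.\<close>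

definition cmul :: "octonion \<Rightarrow> octonion \<Rightarrow> octonion" where
  "cmul p x = omul (ocnj p) x"


section \<open>Associative elements and type\<close>

text \<open>
  Both sets are taken relative to a submodule \<open>N\<close>, regarded as a module in its own right;
  the whole module is \<open>N = UNIV\<close>.
\<close>

definition assoc_elems :: "(octonion \<Rightarrow> 'm \<Rightarrow> 'm::real_vector) \<Rightarrow> 'm set \<Rightarrow> 'm set" where
  "assoc_elems act N = {x \<in> N. \<forall>p q. act (omul p q) x - act p (act q x) = 0}"

definition conj_assoc_elems :: "(octonion \<Rightarrow> 'm \<Rightarrow> 'm::real_vector) \<Rightarrow> 'm set \<Rightarrow> 'm set" where
  "conj_assoc_elems act N = {x \<in> N. \<forall>p q. act (omul p q) x - act q (act p x) = 0}"

text \<open>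
  The library's \<^const>\<open>dim\<close> is \<open>0\<close> on infinite-dimensional spaces, hence the first conjunct.
\<close>

definition has_dim :: "'m::real_vector set \<Rightarrow> nat \<Rightarrow> bool" where
  "has_dim V n \<longleftrightarrow> (\<exists>B. finite B \<and> V \<subseteq> span B) \<and> dim V = n"

definition has_type :: "(octonion \<Rightarrow> 'm \<Rightarrow> 'm::real_vector) \<Rightarrow> 'm set \<Rightarrow> nat \<times> nat \<Rightarrow> bool" where
  "has_type act N t \<longleftrightarrow>
     has_dim (assoc_elems act N) (fst t) \<and> has_dim (conj_assoc_elems act N) (snd t)"


section \<open>Length\<close>

definition oct_span :: "(octonion \<Rightarrow> 'm \<Rightarrow> 'm::real_vector) \<Rightarrow> 'm set \<Rightarrow> 'm set" where
  "oct_span act U = span {act p u |p u. u \<in> U}"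

definition plus_part :: "(octonion \<Rightarrow> 'm \<Rightarrow> 'm::real_vector) \<Rightarrow> 'm set" where
  "plus_part act = oct_span act (assoc_elems act UNIV)"

definition minus_part :: "(octonion \<Rightarrow> 'm \<Rightarrow> 'm::real_vector) \<Rightarrow> 'm set" where
  "minus_part act = oct_span act (conj_assoc_elems act UNIV)"

definition cyclic_plus :: "(octonion \<Rightarrow> 'm \<Rightarrow> 'm::real_vector) \<Rightarrow> 'm set" where
  "cyclic_plus act =
     {0} \<union> {x. oct_gen act x = range (\<lambda>p. act p x) \<and> oct_iso act (oct_gen act x) omul UNIV}"

definition cyclic_minus :: "(octonion \<Rightarrow> 'm \<Rightarrow> 'm::real_vector) \<Rightarrow> 'm set" where
  "cyclic_minus act =
     {0} \<union> {x. oct_gen act x = range (\<lambda>p. act p x) \<and> oct_iso act (oct_gen act x) cmul UNIV}"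

definition sum_of :: "'m::real_vector set \<Rightarrow> nat \<Rightarrow> 'm \<Rightarrow> bool" where
  "sum_of C r x \<longleftrightarrow> (\<exists>c. (\<forall>i<r. c i \<in> C) \<and> x = (\<Sum>i<r. c i))"

definition min_summands :: "'m::real_vector set \<Rightarrow> 'm \<Rightarrow> nat \<Rightarrow> bool" where
  "min_summands C x r \<longleftrightarrow> sum_of C r x \<and> (\<forall>s. sum_of C s x \<longrightarrow> r \<le> s)"

text \<open>
  The decomposition of \<open>x\<close> below is unique, since the module is the direct sum of
  \<^const>\<open>plus_part\<close> and \<^const>\<open>minus_part\<close>.
\<close>

definition has_length :: "(octonion \<Rightarrow> 'm \<Rightarrow> 'm::real_vector) \<Rightarrow> 'm \<Rightarrow> nat \<times> nat \<Rightarrow> bool" where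
  "has_length act x l \<longleftrightarrow>
     (\<exists>y\<in>plus_part act. \<exists>z\<in>minus_part act. x = y + z \<and>
        min_summands (cyclic_plus act) y (fst l) \<and>
        min_summands (cyclic_minus act) z (snd l))"


section \<open>The regular and the conjugate regular module\<close>

lemma norm_omul: "norm (omul x y) = norm x * norm y"
proof -
  obtain a b c d where x: "x = ((a, b), (c, d))" by (metis surj_pair)
  obtain e f g h where y: "y = ((e, f), (g, h))" by (metis surj_pair)
  have "(norm (omul x y))\<^sup>2 = (norm x * norm y)\<^sup>2"
    unfolding x y
    by (simp add: norm_Pair cmod_power2 power_mult_distrib real_sqrt_pow2) algebra
  then show ?thesis
    by (simp add: power2_eq_iff_nonneg)
qed

lemma omul_oone: "omul oone x = x"
proof -
  obtain a b c d where x: "x = ((a, b), (c, d))" by (metis surj_pair)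
  have "omul ((1, 0), (0, 0)) ((a, b), (c, d)) = ((a, b), (c, d))"
    by (simp only: omul.simps qmul.simps qcnj.simps diff_Pair add_Pair) simp
  then show ?thesis by (simp only: oone_def x)
qed

lemma ocnj_oone: "ocnj oone = oone"
  by (simp only: oone_def ocnj.simps qcnj.simps uminus_Pair complex_cnj_one minus_zero)

lemma bilinear_omul: "bilinear omul"
  unfolding bilinear_def
  by (auto intro!: linearI simp: algebra_simps complex_eq_iff)

lemma bilinear_cmul: "bilinear cmul"
  unfolding bilinear_def cmul_def
  by (auto intro!: linearI simp: algebra_simps complex_eq_iff)

lemma oct_module_omul: "oct_module omul"
proof -
  have "assoc3 omul p q x = - assoc3 omul q p x" for p q x
    by (cases p; cases q; cases x) (auto simp: assoc3_def algebra_simps complex_eq_iff)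
  moreover note omul_oone
  ultimately show ?thesis
    using bilinear_omul unfolding oct_module_def by blast
qed

lemma oct_module_cmul: "oct_module cmul"
proof -
  have "assoc3 cmul p q x = - assoc3 cmul q p x" for p q x
    by (cases p; cases q; cases x) (auto simp: assoc3_def cmul_def algebra_simps complex_eq_iff)
  moreover have "cmul oone x = x" for x
    by (simp only: cmul_def ocnj_oone omul_oone)
  ultimately show ?thesis
    using bilinear_cmul unfolding oct_module_def by blast
qed

end

theory Submission
  imports Defs
begin

text \<open>
  Write \<open>A\<close> and \<open>A\<^sup>-\<close> for the associative and the conjugate associative elements of the module \<open>M\<close>.
  For \<open>a \<in> A\<close> the octonions act on the multiples \<open>p a\<close> by left multiplication of \<open>p\<close>, so the
  plus part is a copy of \<open>\<O> \<otimes> A\<close>; for \<open>b \<in> A\<^sup>-\<close> they act on the multiples \<open>p b\<close> by right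
  multiplication of \<open>p\<close>.

  Iterated left multiplications generate all real endomorphisms of the octonions, and they tell
  left multiplication from right multiplication. All that is needed of this density is one
  operator, \<open>scalar_proj\<close>: a composition of four projections built from left multiplications,
  which sends \<open>p a\<close> to \<open>Re(p) a\<close> for \<open>a \<in> A\<close> and annihilates \<open>p b\<close> for \<open>b \<in> A\<^sup>-\<close>. Since
  \<open>Re(q\<^sup>* p)\<close> is the inner product of \<open>q\<close> and \<open>p\<close>, applying it after multiplication by \<open>q\<^sup>*\<close> gives
  \<open>coord q\<close>, the contraction of the tensor factor \<open>\<O>\<close> with \<open>q\<close>. Being made of module operations,
  \<open>coord q\<close> maps every submodule into itself.

  Let \<open>m = y + z\<close> with \<open>y\<close> in the plus part and \<open>z\<close> in the minus part, and let \<open>W\<close> be the space of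
  all \<open>coord q m = coord q y\<close>. Two facts determine the first component of the type.

  \<^item> The associative elements of \<open>\<langle>m\<rangle>\<close> are exactly \<open>W\<close> (\<open>assoc_elems_oct_gen\<close>): the elements of
    \<open>W\<close> are associative and lie in \<open>\<langle>m\<rangle>\<close>, and conversely \<open>\<langle>m\<rangle>\<close> lies in the submodule
    of those sums from the two parts all of whose coordinates are in \<open>W\<close>, while an associative element is its own
    coordinate at the unit.
  \<^item> \<open>W\<close> has dimension \<open>n\<close> (\<open>has_dim_range_coord\<close>): the elements of \<^const>\<open>cyclic_plus\<close> are the
    pure tensors \<open>p a\<close>, so the length of \<open>y\<close> is its tensor rank, and the rank of a tensor
    is the dimension of the space of its contractions.

  The second component comes for free. Replacing the action of \<open>p\<close> by that of \<open>p\<^sup>*\<close> keeps the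
  submodules and interchanges the two signs everywhere, so the first component of the type for the
  conjugate action is the second one for the original action.
\<close>

section \<open>Octonion arithmetic and the projection to the real part\<close>

lemma omul_oone_right: "omul x oone = x"
  by (cases x) (auto simp: oone_def complex_eq_iff zero_prod_def)

lemma omul_ocnj_cancel: "omul (omul x (ocnj p)) p = (p \<bullet> p) *\<^sub>R x"
  by (cases x; cases p)
    (auto simp: inner_complex_def complex_eq_iff algebra_simps)

lemma inner_oone_ocnj_omul: "oone \<bullet> omul (ocnj q) p = q \<bullet> p"
  by (cases q; cases p) (auto simp: oone_def inner_complex_def algebra_simps)

lemma inner_omul_adjoint: "q \<bullet> omul r p = omul (ocnj r) q \<bullet> p"
  by (cases q; cases p; cases r) (auto simp: inner_complex_def algebra_simps)

lemma ocnj_ocnj: "ocnj (ocnj p) = p"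
  by (cases p) auto

lemma ocnj_omul: "ocnj (omul p q) = omul (ocnj q) (ocnj p)"
  by (cases p; cases q) (auto simp: complex_eq_iff algebra_simps)

lemma linear_ocnj: "linear ocnj"
  by (rule linearI) auto

lemma inner_oone_oone: "oone \<bullet> oone = 1"
  by (simp add: oone_def inner_complex_def)

text \<open>
  If \<open>u, v, w\<close> is an oriented quaternionic triple, \<open>v w = u\<close>, then \<open>u (v (w x))\<close> is \<open>- x\<close> on
  the quaternion subalgebra spanned by \<open>1, u, v, w\<close> and \<open>x\<close> on its orthogonal complement. So this is
  the orthogonal projection onto that subalgebra.
\<close>

definition triple_proj :: "(octonion \<Rightarrow> 'm \<Rightarrow> 'm::real_vector) \<Rightarrow> octonion \<Rightarrow> octonion \<Rightarrow> octonion \<Rightarrow> 'm \<Rightarrow> 'm" where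
  "triple_proj act u v w x = (1/2) *\<^sub>R (x - act u (act v (act w x)))"

text \<open>
  The triples are four lines of the Fano plane of imaginary units: three lines through one point,
  which together cover the plane, and one line that misses this point. No unit lies on all four
  lines, so on the octonions only the reals survive all four projections. For the
  opposite multiplication each projection is onto the complement instead, and nothing survives
  because the lines cover everything.
\<close>

definition scalar_proj :: "(octonion \<Rightarrow> 'm \<Rightarrow> 'm::real_vector) \<Rightarrow> 'm \<Rightarrow> 'm" where
  "scalar_proj act x =
     triple_proj act ((\<i>, 0), (0, 0)) ((0, 1), (0, 0)) ((0, \<i>), (0, 0))
    (triple_proj act ((\<i>, 0), (0, 0)) ((0, 0), (1, 0)) ((0, 0), (\<i>, 0))
    (triple_proj act ((\<i>, 0), (0, 0)) ((0, 0), (0, \<i>)) ((0, 0), (0, 1))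
    (triple_proj act ((0, 1), (0, 0)) ((0, 0), (1, 0)) ((0, 0), (0, 1)) x)))"

lemma triple_proj_omul:
  "triple_proj omul ((\<i>, 0), (0, 0)) ((0, 1), (0, 0)) ((0, \<i>), (0, 0)) ((a, b), (c, d)) = ((a, b), (0, 0))"
  "triple_proj omul ((\<i>, 0), (0, 0)) ((0, 0), (1, 0)) ((0, 0), (\<i>, 0)) ((a, b), (c, d)) = ((a, 0), (c, 0))"
  "triple_proj omul ((\<i>, 0), (0, 0)) ((0, 0), (0, \<i>)) ((0, 0), (0, 1)) ((a, b), (c, d)) = ((a, 0), (0, d))"
  "triple_proj omul ((0, 1), (0, 0)) ((0, 0), (1, 0)) ((0, 0), (0, 1)) ((a, b), (c, d)) =
     ((of_real (Re a), of_real (Re b)), (of_real (Re c), of_real (Re d)))"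
  by (auto simp: triple_proj_def complex_eq_iff)

text \<open>
  The opposite multiplication reverses the orientation of the triple and thereby changes the sign
  of the triple product, hence the complementary projections.
\<close>

lemma triple_proj_omul_opposite:
  "triple_proj (\<lambda>p x. omul x p) ((\<i>, 0), (0, 0)) ((0, 1), (0, 0)) ((0, \<i>), (0, 0)) ((a, b), (c, d)) = ((0, 0), (c, d))"
  "triple_proj (\<lambda>p x. omul x p) ((\<i>, 0), (0, 0)) ((0, 0), (1, 0)) ((0, 0), (\<i>, 0)) ((a, b), (c, d)) = ((0, b), (0, d))"
  "triple_proj (\<lambda>p x. omul x p) ((\<i>, 0), (0, 0)) ((0, 0), (0, \<i>)) ((0, 0), (0, 1)) ((a, b), (c, d)) = ((0, b), (c, 0))"
  "triple_proj (\<lambda>p x. omul x p) ((0, 1), (0, 0)) ((0, 0), (1, 0)) ((0, 0), (0, 1)) ((a, b), (c, d)) =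
     ((\<i> * of_real (Im a), \<i> * of_real (Im b)), (\<i> * of_real (Im c), \<i> * of_real (Im d)))"
  by (auto simp: triple_proj_def complex_eq_iff)

lemma scalar_proj_omul: "scalar_proj omul p = (oone \<bullet> p) *\<^sub>R oone"
proof -
  obtain a b c d where p: "p = ((a, b), (c, d))" by (metis surj_pair)
  show ?thesis
    unfolding p scalar_proj_def triple_proj_omul
    by (simp add: oone_def inner_complex_def complex_eq_iff)
qed

lemma scalar_proj_omul_opposite: "scalar_proj (\<lambda>p x. omul x p) p = 0"
proof -
  obtain a b c d where p: "p = ((a, b), (c, d))" by (metis surj_pair)
  show ?thesis
    unfolding p scalar_proj_def triple_proj_omul_opposite by (simp add: zero_prod_def)
qed


section \<open>Octonionic coordinates of module elements\<close>

(* From here on octonions are treated as single vectors: quantifiers over them should not be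
   split into components, nor products be expanded. *)
declare split_paired_All [simp del] split_paired_Ex [simp del]
  omul.simps [simp del] ocnj.simps [simp del] qmul.simps [simp del] qcnj.simps [simp del]

text \<open>
  The octonions act on the multiples of \<open>a\<close> through some multiplication \<open>mul\<close> of the coefficients,
  which is \<^const>\<open>omul\<close> for associative \<open>a\<close> and its opposite for conjugate associative \<open>a\<close>. Operators
  built from the action can then be computed on the coefficients.
\<close>

lemma triple_proj_orbit:
  assumes "linear (\<lambda>p. act p a)" and "\<And>r p. act r (act p a) = act (mul r p) a"
  shows "triple_proj act u v w (act p a) = act (triple_proj mul u v w p) a"
  using assms(2) linear_scale[OF assms(1)] linear_diff[OF assms(1)]
  by (simp add: triple_proj_def)

lemma scalar_proj_orbit:
  assumes "linear (\<lambda>p. act p a)" and "\<And>r p. act r (act p a) = act (mul r p) a"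
  shows "scalar_proj act (act p a) = act (scalar_proj mul p) a"
  unfolding scalar_proj_def triple_proj_orbit[OF assms] ..

lemma triple_proj_mem_submodule:
  assumes "oct_submodule act N" "x \<in> N"
  shows "triple_proj act u v w x \<in> N"
  using assms unfolding oct_submodule_def triple_proj_def
  by (auto intro!: subspace_scale subspace_diff)

lemma oct_gen_minimal: "oct_submodule act N \<Longrightarrow> x \<in> N \<Longrightarrow> oct_gen act x \<subseteq> N"
  by (simp add: oct_gen_def hull_minimal)

lemma mem_oct_gen: "x \<in> oct_gen act x"
  by (simp add: oct_gen_def hull_inc)

locale unital_octonion_action =
  fixes act :: "octonion \<Rightarrow> 'm \<Rightarrow> 'm::real_vector"
  assumes bilinear_act: "bilinear act" and act_oone: "act oone x = x"
begin

lemma linear_act: "linear (act p)" and linear_act_left: "linear (\<lambda>p. act p x)"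
  using bilinear_act by (auto simp: bilinear_def)

lemma act_assoc: "a \<in> assoc_elems act UNIV \<Longrightarrow> act p (act q a) = act (omul p q) a"
  by (simp add: assoc_elems_def)

lemma act_conj_assoc: "b \<in> conj_assoc_elems act UNIV \<Longrightarrow> act p (act q b) = act (omul q p) b"
  by (simp add: conj_assoc_elems_def)

lemma subspace_assoc_elems: "subspace (assoc_elems act UNIV)"
  unfolding assoc_elems_def subspace_def
  by (simp add: linear_0[OF linear_act] linear_add[OF linear_act] linear_scale[OF linear_act])

lemma oct_submodule_oct_span:
  assumes "\<And>p q u. u \<in> U \<Longrightarrow> \<exists>s. act p (act q u) = act s u"
  shows "oct_submodule act (oct_span act U)"
proof -
  have "act p ` oct_span act U \<subseteq> oct_span act U" for p
    unfolding oct_span_def linear_span_image[OF linear_act, symmetric]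
    by (rule span_mono) (use assms in blast)
  then have "act p x \<in> oct_span act U" if "x \<in> oct_span act U" for p x
    using that by blast
  then show ?thesis
    by (simp add: oct_submodule_def oct_span_def)
qed

lemma oct_submodule_plus_part: "oct_submodule act (plus_part act)"
  unfolding plus_part_def by (rule oct_submodule_oct_span) (blast intro: act_assoc)

lemma oct_submodule_minus_part: "oct_submodule act (minus_part act)"
  unfolding minus_part_def by (rule oct_submodule_oct_span) (blast intro: act_conj_assoc)

lemma linear_scalar_proj: "linear (scalar_proj act)"
proof -
  have *: "linear (triple_proj act u v w)" for u v w
    unfolding triple_proj_def
    by (intro linear_compose_scale_right linear_compose_sub linear_ident
        linear_compose[OF _ linear_act, unfolded o_def] linear_act)
  show ?thesis
    using linear_compose[OF linear_compose[OF linear_compose[OF * *] *] *]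
    by (simp add: scalar_proj_def[abs_def] o_def)
qed

text \<open>
  On \<open>p a\<close> with \<open>a\<close> associative this is \<open>(q \<bullet> p) a\<close>, the contraction of \<open>p \<otimes> a\<close> with \<open>q\<close>.
\<close>

definition coord :: "octonion \<Rightarrow> 'm \<Rightarrow> 'm" where
  "coord q x = scalar_proj act (act (ocnj q) x)"

lemma linear_coord: "linear (coord q)"
  using linear_compose[OF linear_act linear_scalar_proj] by (simp add: coord_def[abs_def] o_def)

lemma linear_coord_left: "linear (\<lambda>q. coord q x)"
  using linear_compose[OF linear_compose[OF linear_ocnj linear_act_left] linear_scalar_proj]
  by (simp add: coord_def[abs_def] o_def)

lemma coord_mem_submodule: "oct_submodule act N \<Longrightarrow> x \<in> N \<Longrightarrow> coord q x \<in> N"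
  unfolding coord_def scalar_proj_def
  by (intro triple_proj_mem_submodule) (auto simp: oct_submodule_def)

lemma coord_act_assoc:
  assumes "a \<in> assoc_elems act UNIV"
  shows "coord q (act p a) = (q \<bullet> p) *\<^sub>R a"
  using scalar_proj_orbit[of act a omul, OF linear_act_left act_assoc[OF assms]]
  by (simp add: coord_def act_assoc[OF assms] scalar_proj_omul inner_oone_ocnj_omul
      linear_scale[OF linear_act_left] act_oone)

lemma coord_act_conj_assoc:
  assumes "b \<in> conj_assoc_elems act UNIV"
  shows "coord q (act p b) = 0"
  using scalar_proj_orbit[of act b "\<lambda>p x. omul x p", OF linear_act_left act_conj_assoc[OF assms]]
  by (simp add: coord_def act_conj_assoc[OF assms] scalar_proj_omul_opposite
      linear_0[OF linear_act_left])

lemma coord_minus_part: "z \<in> minus_part act \<Longrightarrow> coord q z = 0"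
  unfolding minus_part_def oct_span_def
  by (rule linear_eq_0_on_span[OF linear_coord]) (auto simp: coord_act_conj_assoc)

lemma coord_mem_assoc_elems:
  assumes "y \<in> plus_part act"
  shows "coord q y \<in> assoc_elems act UNIV"
proof -
  have "coord q ` plus_part act \<subseteq> assoc_elems act UNIV"
    unfolding plus_part_def oct_span_def linear_span_image[OF linear_coord, symmetric]
    by (rule span_minimal[OF _ subspace_assoc_elems])
      (auto simp: coord_act_assoc intro: subspace_scale[OF subspace_assoc_elems])
  then show ?thesis using assms by blast
qed

lemma linear_eq_on_plus_part:
  assumes "linear f" "linear g"
    and "\<And>p a. a \<in> assoc_elems act UNIV \<Longrightarrow> f (act p a) = g (act p a)"
    and "y \<in> plus_part act"
  shows "f y = g y"
  by (rule linear_eq_on_span[OF assms(1,2) _ assms(4)[unfolded plus_part_def oct_span_def]])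
    (use assms(3) in blast)

text \<open>
  Contraction turns left multiplication by \<open>r\<close> into its adjoint, which is left multiplication by
  \<open>r\<^sup>*\<close>. Every coordinate of \<open>r y\<close> is thus already a coordinate of \<open>y\<close>, and the space of
  coordinates does not grow when passing to the submodule generated by \<open>y\<close>.
\<close>

lemma coord_act:
  assumes "y \<in> plus_part act"
  shows "coord q (act r y) = coord (omul (ocnj r) q) y"
  using linear_compose[OF linear_act linear_coord, unfolded o_def] linear_coord _ assms
  by (rule linear_eq_on_plus_part) (simp add: coord_act_assoc act_assoc inner_omul_adjoint)

text \<open>
  Linearity reduces this to the expansion of an octonion in the standard orthonormal basis.
\<close>

lemma sum_act_coord:
  assumes "y \<in> plus_part act"
  shows "(\<Sum>e\<in>Basis. act e (coord e y)) = y"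
proof -
  have *: "linear (\<lambda>y. \<Sum>e\<in>Basis. act e (coord e y))"
    by (rule linear_compose_sum)
      (use linear_compose[OF linear_coord linear_act] in \<open>simp add: o_def\<close>)
  have "(\<Sum>e\<in>Basis. act e (coord e (act p a))) = act p a" if a: "a \<in> assoc_elems act UNIV" for p a
  proof -
    have "(\<Sum>e\<in>Basis. act e (coord e (act p a))) = act (\<Sum>e\<in>Basis. (e \<bullet> p) *\<^sub>R e) a"
      by (simp only: coord_act_assoc[OF a] linear_sum[OF linear_act_left]
          linear_scale[OF linear_act_left] linear_scale[OF linear_act])
    also have "(\<Sum>e\<in>Basis. (e \<bullet> p) *\<^sub>R e) = p"
      by (simp only: inner_commute[of _ p] euclidean_representation)
    finally show ?thesis .
  qed
  with * linear_ident show ?thesis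
    using assms by (rule linear_eq_on_plus_part)
qed

section \<open>Cyclic elements are multiples of associative elements\<close>

text \<open>
  Under an isomorphism from the module generated by \<open>x\<close> to the octonions, take for \<open>a\<close> the preimage of
  the unit: it is associative because \<open>(p q) 1 = p (q 1)\<close>, and \<open>x\<close> is the multiple of \<open>a\<close> by
  the image of \<open>x\<close>.
\<close>

lemma cyclic_plus_imp_multiple:
  assumes "x \<in> cyclic_plus act"
  shows "\<exists>p a. a \<in> assoc_elems act UNIV \<and> x = act p a"
proof (cases "x = 0")
  case True
  then show ?thesis
    using subspace_0[OF subspace_assoc_elems] linear_0[OF linear_act] by metis
next
  case False
  then have "oct_iso act (oct_gen act x) omul UNIV"
    using assms unfolding cyclic_plus_def by blast
  then obtain f where bij: "bij_betw f (oct_gen act x) UNIV"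
    and f: "\<And>p y. y \<in> oct_gen act x \<Longrightarrow> f (act p y) = omul p (f y)"
    unfolding oct_iso_def by blast
  have closed: "act p y \<in> oct_gen act x" if "y \<in> oct_gen act x" for p y
    using oct_submodule_oct_gen that by (auto simp: oct_submodule_def)
  from bij obtain a where a: "a \<in> oct_gen act x" "f a = oone"
    unfolding bij_betw_def by (metis UNIV_I imageE)
  have inj: "y = z" if "f y = f z" "y \<in> oct_gen act x" "z \<in> oct_gen act x" for y z
    using bij that by (auto simp: bij_betw_def dest: inj_onD)
  have "act (omul p q) a = act p (act q a)" for p q
    by (rule inj) (auto simp: a f closed omul_oone_right)
  then have "a \<in> assoc_elems act UNIV"
    by (simp add: assoc_elems_def)
  moreover have "x = act (f x) a"
    by (rule inj) (auto simp: a f closed omul_oone_right mem_oct_gen)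
  ultimately show ?thesis
    by blast
qed

text \<open>
  A nonzero \<open>p\<close> has an inverse, so \<open>p a\<close> and \<open>a\<close> have the same multiples. These form a submodule
  because \<open>a\<close> is associative, and \<open>q \<mapsto> q a\<close> is an isomorphism onto it, injective since
  \<open>q a\<close> has the coordinate \<open>(q \<bullet> q) a\<close>.
\<close>

lemma multiple_in_cyclic_plus:
  assumes a: "a \<in> assoc_elems act UNIV"
  shows "act p a \<in> cyclic_plus act"
proof (cases "act p a = 0")
  case True
  then show ?thesis by (simp add: cyclic_plus_def)
next
  case False
  have "p \<noteq> 0" "a \<noteq> 0"
    using False linear_0[OF linear_act_left] linear_0[OF linear_act] by metis+
  let ?O = "range (\<lambda>q. act q a)"
  have eq: "range (\<lambda>q. act q (act p a)) = ?O"
  proof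
    show "range (\<lambda>q. act q (act p a)) \<subseteq> ?O"
      by (auto simp: act_assoc[OF a])
    have "act ((1 / (p \<bullet> p)) *\<^sub>R omul q (ocnj p)) (act p a) = act q a" for q
    proof -
      have "act ((1 / (p \<bullet> p)) *\<^sub>R omul q (ocnj p)) (act p a) =
          (1 / (p \<bullet> p)) *\<^sub>R act (omul (omul q (ocnj p)) p) a"
        by (subst linear_scale[OF linear_act_left]) (simp only: act_assoc[OF a])
      with \<open>p \<noteq> 0\<close> show ?thesis
        by (simp add: omul_ocnj_cancel linear_scale[OF linear_act_left])
    qed
    then show "?O \<subseteq> range (\<lambda>q. act q (act p a))"
      by (metis image_subsetI rangeI)
  qed
  have "oct_submodule act ?O"
    using linear_subspace_image[OF linear_act_left subspace_UNIV]
    by (auto simp: oct_submodule_def act_assoc[OF a])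
  then have "oct_gen act (act p a) \<subseteq> ?O"
    by (rule oct_gen_minimal) blast
  moreover have "range (\<lambda>q. act q (act p a)) \<subseteq> oct_gen act (act p a)"
    using oct_submodule_oct_gen[of act] mem_oct_gen[of _ act] by (fastforce simp: oct_submodule_def)
  ultimately have gen: "oct_gen act (act p a) = ?O"
    using eq by blast
  have inj: "inj (\<lambda>q. act q a)"
  proof (rule linear_injective_0[OF linear_act_left, THEN iffD2], intro allI impI)
    fix q assume "act q a = 0"
    then have "(q \<bullet> q) *\<^sub>R a = 0"
      using coord_act_assoc[OF a, of q q] linear_0[OF linear_coord] by simp
    then show "q = 0" using \<open>a \<noteq> 0\<close> by simp
  qed
  define f where "f = inv (\<lambda>q. act q a)"
  have f: "f (act q a) = q" for q
    unfolding f_def by (rule inv_f_f[OF inj])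
  have "bij_betw f ?O UNIV"
    by (rule bij_betw_byWitness[where f' = "\<lambda>q. act q a"]) (auto simp: f)
  moreover have "f (x + y) = f x + f y" if "x \<in> ?O" "y \<in> ?O" for x y
    using that by (auto simp: f linear_add[OF linear_act_left, symmetric])
  moreover have "f (r *\<^sub>R x) = r *\<^sub>R f x" if "x \<in> ?O" for r x
    using that by (auto simp: f linear_scale[OF linear_act_left, symmetric])
  moreover have "f (act q x) = omul q (f x)" if "x \<in> ?O" for q x
    using that by (auto simp: f act_assoc[OF a])
  ultimately have "oct_iso act ?O omul UNIV"
    unfolding oct_iso_def by blast
  then show ?thesis
    by (simp add: cyclic_plus_def gen eq)
qed

section \<open>Associative elements of a submodule with one generator\<close>

text \<open>
  A tensor has rank equal to the dimension of the space \<open>W\<close> of its contractions. If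
  \<open>y\<close> is a sum of \<open>n\<close> terms \<open>p\<^sub>i a\<^sub>i\<close>, then the \<open>a\<^sub>i\<close> span a space containing \<open>W\<close>; conversely,
  expanding the coefficients of \<open>y\<close> in a basis of \<open>W\<close> writes \<open>y\<close> with as many terms as the basis
  has elements.
\<close>

lemma has_dim_range_coord:
  assumes y: "y \<in> plus_part act" and min: "min_summands (cyclic_plus act) y n"
  shows "has_dim (range (\<lambda>q. coord q y)) n"
proof -
  let ?W = "range (\<lambda>q. coord q y)"
  obtain c where c: "\<And>i. i < n \<Longrightarrow> c i \<in> cyclic_plus act" and y_sum: "y = (\<Sum>i<n. c i)"
    using min by (auto simp: min_summands_def sum_of_def)
  have "\<forall>i. \<exists>p a. i < n \<longrightarrow> a \<in> assoc_elems act UNIV \<and> c i = act p a"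
    using cyclic_plus_imp_multiple[OF c] by blast
  then obtain p a where pa: "\<And>i. i < n \<Longrightarrow> a i \<in> assoc_elems act UNIV \<and> c i = act (p i) (a i)"
    by metis
  have W_le: "?W \<subseteq> span (a ` {..<n})"
  proof clarify
    fix q
    have "coord q y = (\<Sum>i<n. (q \<bullet> p i) *\<^sub>R a i)"
      by (simp add: y_sum linear_sum[OF linear_coord] pa coord_act_assoc)
    then show "coord q y \<in> span (a ` {..<n})"
      by (simp only:) (intro span_sum span_scale span_base imageI)
  qed
  have "dim ?W \<le> card (a ` {..<n})"
    by (rule dim_le_card[OF W_le]) simp
  also have "\<dots> \<le> n"
    using card_image_le[of "{..<n}" a] by simp
  finally have dim_le: "dim ?W \<le> n" .
  obtain B where B: "B \<subseteq> ?W" "independent B" "?W \<subseteq> span B" "card B = dim ?W"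
    using basis_exists by blast
  have "finite B"
    using independent_span_bound[OF _ B(2)] B(1) W_le by (meson finite_imageI finite_lessThan subset_trans)
  obtain h where h: "bij_betw h {..<dim ?W} B"
    using \<open>finite B\<close> B(4) by (metis bij_betw_from_nat_into_finite)
  have "\<exists>g. coord e y = (\<Sum>b\<in>B. g b *\<^sub>R b)" for e
    using B(3) span_finite[OF \<open>finite B\<close>] by blast
  then obtain g where g: "\<And>e. coord e y = (\<Sum>b\<in>B. g e b *\<^sub>R b)"
    by metis
  (* Regrouping y by basis vectors of the contraction space instead of by basis octonions. *)
  define r where "r b = (\<Sum>e\<in>Basis. g e b *\<^sub>R e)" for b
  have "y = (\<Sum>e\<in>Basis. act e (\<Sum>b\<in>B. g e b *\<^sub>R b))"
    using sum_act_coord[OF y] g by simp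
  also have "\<dots> = (\<Sum>b\<in>B. act (r b) b)"
    unfolding r_def
    by (simp add: linear_sum[OF linear_act] linear_sum[OF linear_act_left]
        linear_scale[OF linear_act] linear_scale[OF linear_act_left] sum.swap[of _ B])
  also have "\<dots> = (\<Sum>i<dim ?W. act (r (h i)) (h i))"
    by (rule sum.reindex_bij_betw[OF h, symmetric])
  finally have "y = (\<Sum>i<dim ?W. act (r (h i)) (h i))" .
  moreover have "act (r (h i)) (h i) \<in> cyclic_plus act" if "i < dim ?W" for i
  proof -
    have "h i \<in> B" using h that by (auto simp: bij_betw_def)
    then obtain q where "h i = coord q y"
      using B(1) by blast
    then show ?thesis
      using coord_mem_assoc_elems[OF y] by (simp add: multiple_in_cyclic_plus)
  qed
  ultimately have "sum_of (cyclic_plus act) (dim ?W) y"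
    unfolding sum_of_def by (intro exI[of _ "\<lambda>i. act (r (h i)) (h i)"]) blast
  then have "n \<le> dim ?W"
    using min by (simp add: min_summands_def)
  with dim_le W_le show ?thesis
    unfolding has_dim_def by (metis finite_imageI finite_lessThan le_antisym)
qed

text \<open>
  The coordinates of \<open>y + z\<close> are those of \<open>y\<close>, are associative, and lie in every submodule that
  contains \<open>y + z\<close>. They exhaust the associative elements because having all coordinates in this
  space is a property that survives the action.
\<close>

lemma assoc_elems_oct_gen:
  assumes y: "y \<in> plus_part act" and z: "z \<in> minus_part act"
  shows "assoc_elems act (oct_gen act (y + z)) = range (\<lambda>q. coord q y)" (is "?A = ?W")
proof
  have coord_yz: "coord q (y' + z') = coord q y'" if "z' \<in> minus_part act" for q y' z'
    by (simp add: linear_add[OF linear_coord] coord_minus_part[OF that])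
  show "?W \<subseteq> ?A"
  proof clarify
    fix q
    have "coord q (y + z) \<in> oct_gen act (y + z)"
      by (rule coord_mem_submodule[OF oct_submodule_oct_gen mem_oct_gen])
    then show "coord q y \<in> ?A"
      using coord_mem_assoc_elems[OF y, of q] coord_yz[OF z] by (simp add: assoc_elems_def)
  qed
  let ?S = "{y' + z' |y' z'. y' \<in> plus_part act \<and> (\<forall>q. coord q y' \<in> ?W) \<and> z' \<in> minus_part act}"
  have subW: "subspace ?W"
    using linear_subspace_image[OF linear_coord_left subspace_UNIV] .
  have plus: "subspace (plus_part act)" "\<And>p x. x \<in> plus_part act \<Longrightarrow> act p x \<in> plus_part act"
    using oct_submodule_plus_part by (auto simp: oct_submodule_def)
  have minus: "subspace (minus_part act)" "\<And>p x. x \<in> minus_part act \<Longrightarrow> act p x \<in> minus_part act"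
    using oct_submodule_minus_part by (auto simp: oct_submodule_def)
  have "subspace {y' \<in> plus_part act. \<forall>q. coord q y' \<in> ?W}"
    by (rule subspaceI)
      (simp_all add: linear_0[OF linear_coord] linear_add[OF linear_coord] linear_scale[OF linear_coord]
        subspace_0[OF plus(1)] subspace_add[OF plus(1)] subspace_scale[OF plus(1)]
        subspace_0[OF subW] subspace_add[OF subW] subspace_scale[OF subW])
  from subspace_sums[OF this minus(1)] have "subspace ?S"
    by (simp add: conj_assoc)
  moreover have "act r x \<in> ?S" if "x \<in> ?S" for r x
  proof -
    obtain y' z' where x: "x = y' + z'" "y' \<in> plus_part act" "z' \<in> minus_part act"
      and W: "\<And>q. coord q y' \<in> ?W"
      using \<open>x \<in> ?S\<close> by blast
    have "act r x = act r y' + act r z'"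
      by (simp add: x linear_add[OF linear_act])
    moreover have "coord q (act r y') \<in> ?W" for q
      using W by (simp only: coord_act[OF x(2)])
    ultimately show ?thesis
      using plus(2)[OF x(2)] minus(2)[OF x(3)] by blast
  qed
  ultimately have "oct_submodule act ?S"
    by (simp only: oct_submodule_def) blast
  then have gen: "oct_gen act (y + z) \<subseteq> ?S"
    by (rule oct_gen_minimal) (use y z in blast)
  show "?A \<subseteq> ?W"
  proof
    fix x assume x: "x \<in> ?A"
    then have "coord oone x = x"
      using coord_act_assoc[of x oone oone] by (simp add: assoc_elems_def inner_oone_oone act_oone)
    moreover have "x \<in> ?S"
      using x gen unfolding assoc_elems_def by blast
    then obtain y' z' where "x = y' + z'" "coord oone y' \<in> ?W" "z' \<in> minus_part act"
      by blast
    then have "coord oone x \<in> ?W"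
      by (simp only: coord_yz)
    ultimately show "x \<in> ?W" by simp
  qed
qed

lemma has_dim_assoc_elems_oct_gen:
  assumes "has_length act m (n, k)"
  shows "has_dim (assoc_elems act (oct_gen act m)) n"
  using assms has_dim_range_coord assoc_elems_oct_gen by (auto simp: has_length_def)

end

section \<open>The conjugate action\<close>

text \<open>
  Conjugation is an anti-automorphism, so this action exchanges associative with conjugate
  associative elements, and \<^const>\<open>omul\<close> with \<^const>\<open>cmul\<close>.
\<close>

definition conj_act :: "(octonion \<Rightarrow> 'm \<Rightarrow> 'm) \<Rightarrow> octonion \<Rightarrow> 'm \<Rightarrow> 'm" where
  "conj_act act p x = act (ocnj p) x"

lemma conj_act_conj_act: "conj_act (conj_act act) = act"
  by (simp add: conj_act_def fun_eq_iff ocnj_ocnj)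

lemma all_ocnj: "(\<forall>p. P (ocnj p)) \<longleftrightarrow> (\<forall>p. P p)"
  by (metis ocnj_ocnj)

lemma range_ocnj: "range (\<lambda>p. f (ocnj p)) = range f"
  by (metis (no_types, lifting) image_cong image_image ocnj_ocnj surj_def)

lemma oct_gen_conj_act: "oct_gen (conj_act act) = oct_gen act"
proof -
  have "oct_submodule (conj_act act) = oct_submodule act"
    using all_ocnj[of "\<lambda>p. \<forall>x\<in>N. act p x \<in> N" for N]
    by (simp add: oct_submodule_def conj_act_def fun_eq_iff)
  then show ?thesis unfolding oct_gen_def[abs_def] by simp
qed

lemma assoc_elems_conj_act: "assoc_elems (conj_act act) N = conj_assoc_elems act N"
proof -
  have "(\<forall>p q. act (omul (ocnj q) (ocnj p)) x - act (ocnj p) (act (ocnj q) x) = 0) \<longleftrightarrow>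
        (\<forall>p q. act (omul p q) x - act q (act p x) = 0)" for x
    by (metis ocnj_ocnj)
  then show ?thesis
    by (simp only: assoc_elems_def conj_assoc_elems_def conj_act_def ocnj_omul)
qed

lemma oct_span_conj_act: "oct_span (conj_act act) U = oct_span act U"
proof -
  have "{conj_act act p u |p u. u \<in> U} = {act p u |p u. u \<in> U}"
    unfolding conj_act_def by (metis ocnj_ocnj)
  then show ?thesis by (simp add: oct_span_def)
qed

lemma plus_part_conj_act: "plus_part (conj_act act) = minus_part act"
  by (simp add: plus_part_def minus_part_def oct_span_conj_act assoc_elems_conj_act)

lemma cyclic_plus_conj_act: "cyclic_plus (conj_act act) = cyclic_minus act"
proof -
  have "(\<forall>p. \<forall>x\<in>V. f (act (ocnj p) x) = omul p (f x)) \<longleftrightarrow>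
        (\<forall>p. \<forall>x\<in>V. f (act p x) = omul (ocnj p) (f x))" for f V
    by (metis ocnj_ocnj)
  then have "oct_iso (conj_act act) V omul UNIV = oct_iso act V cmul UNIV" for V
    by (simp only: oct_iso_def conj_act_def cmul_def)
  moreover have "range (\<lambda>p. conj_act act p x) = range (\<lambda>p. act p x)" for x
    unfolding conj_act_def by (rule range_ocnj)
  ultimately show ?thesis
    by (simp add: cyclic_plus_def cyclic_minus_def oct_gen_conj_act)
qed

lemma has_length_conj_act:
  assumes "has_length act m (n, k)"
  shows "has_length (conj_act act) m (k, n)"
proof -
  have "minus_part (conj_act act) = plus_part act"
    "cyclic_minus (conj_act act) = cyclic_plus act"
    by (metis plus_part_conj_act cyclic_plus_conj_act conj_act_conj_act)+
  then show ?thesis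
    using assms unfolding has_length_def plus_part_conj_act cyclic_plus_conj_act
    by (metis add.commute fst_conv snd_conv)
qed

lemma unital_octonion_action_conj_act:
  assumes "unital_octonion_action act"
  shows "unital_octonion_action (conj_act act)"
proof -
  interpret unital_octonion_action act by fact
  have "linear (\<lambda>p. conj_act act p x)" for x
    using linear_compose[OF linear_ocnj linear_act_left] by (simp add: conj_act_def o_def)
  then show ?thesis
    by unfold_locales
      (auto simp: bilinear_def conj_act_def linear_act act_oone ocnj_oone)
qed

theorem theorem3p3:
  fixes act :: "octonion \<Rightarrow> 'm::real_vector \<Rightarrow> 'm" and m :: 'm and n k :: nat
  assumes "oct_module act"
    and "has_length act m (n, k)"
  shows "has_type act (oct_gen act m) (n, k)"
proof -
  interpret unital_octonion_action act
    using assms(1) by unfold_locales (auto simp: oct_module_def)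
  interpret conj: unital_octonion_action "conj_act act"
    by (rule unital_octonion_action_conj_act) unfold_locales
  have "has_dim (conj_assoc_elems act (oct_gen act m)) k"
    using conj.has_dim_assoc_elems_oct_gen[OF has_length_conj_act[OF assms(2)]]
    by (simp add: assoc_elems_conj_act oct_gen_conj_act)
  then show ?thesis
    using has_dim_assoc_elems_oct_gen[OF assms(2)] by (simp add: has_type_def)
qed

end
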